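(* Let $A \in K[D]$ and suppose $\operatorname{Sym}(A) = S_1 S_2 S_3$, where $S_1,S_2,S_3\in K[X]$ are homogeneous polynomials with $\gcd(S_1,S_3)=1$. Let $U$, $V$ and $W$ be respectively the sets of common obstacles to factorizations of $A$ of the types $(S_1)(S_2S_3)$, $(S_1 S_2)(S_3)$, and $(S_1)(S_2)(S_3)$. Suppose that $V$ and $U$ are non-empty and that the order of the common obstacles in $V$ and the order of the common obstacles in $U$ are both less than $\operatorname{ord}(S_3)$. Then $W$ is non-empty and $V = W$.
   Context: $K$ is a field of characteristic zero with commuting derivations $\partial_1,\dots,\partial_n$. $K[D]=K[D_1,\dots,D_n]$ is the corresponding non-commutative ring of linear partial differential operators (LPDOs): the $D_i$ commute with each other, and $D_i\circ f = f D_i + \partial_i(f)$ for $f\in K$; multiplication in $K[D]$ is written $\circ$. Every nonzero $L\in K[D]$ has the form $L=\sum_{|J|\le d} a_J D^J$ with $a_J\in K$, where $J=(j_1,\dots,j_n)\in\mathbb{N}^n$, $|J|=j_1+\dots+j_n$, $D^J=D_1^{j_1}\cdots D_n^{j_n}$, and $a_J\neq 0$ for some $J$ with $|J|=d$. Then $d$ is the order $\operatorname{ord}(L)$ of $L$, and $\operatorname{ord}(0)=-\infty$. The (principal) symbol of $L$ is the homogeneous commutative polynomial $\operatorname{Sym}(L)=\sum_{|J|=d}a_J X^J\in K[X]=K[X_1,\dots,X_n]$, and $\operatorname{Sym}(0)=0$. For a homogeneous polynomial $S\in K[X]$, $\operatorname{ord}(S)$ denotes its degree (with $-\infty$ for $S=0$).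 If $L\in K[D]$ and $\operatorname{Sym}(L)=S_1\cdots S_k$, a factorization $L=F_1\circ\dots\circ F_k$ with $F_i\in K[D]$ and $\operatorname{Sym}(F_i)=S_i$ for all $i$ is said to be of type $(S_1)\cdots(S_k)$. For $A\in K[D]$ with $\operatorname{Sym}(A)=S_1\cdots S_k$, an operator $R\in K[D]$ is called a common obstacle to factorization of $A$ of the type $(S_1)\cdots(S_k)$ if the operator $A-R$ has a factorization of the type $(S_1)\cdots(S_k)$ and $R$ has minimal possible order among all operators with this property. In particular, all common obstacles of a given type have the same order. *)

theory Defs
  imports "HOL-Library.Poly_Mapping" "HOL-Library.Extended_Real"
begin

locale commuting_derivations =
  fixes \<delta> :: "'n::{finite,linorder} \<Rightarrow> 'a::field_char_0 \<Rightarrow> 'a"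
  assumes deriv_add: "\<delta> i (f + g) = \<delta> i f + \<delta> i g"
    and deriv_mult: "\<delta> i (f * g) = \<delta> i f * g + f * \<delta> i g"
    and deriv_commute: "\<delta> i (\<delta> j f) = \<delta> j (\<delta> i f)"

text \<open>
  The index set of the variables is a finite linearly ordered type \<^typ>\<open>'n\<close>, so that
  \<open>n = CARD('n)\<close>; a multi-index is an element of \<open>'n \<Rightarrow>\<^sub>0 nat\<close>.
  The linear order only serves to write out \<open>D\<^sup>J = D\<^sub>1\<^bsup>j1\<^esup> \<dots> D\<^sub>n\<^bsup>jn\<^esup>\<close>.

  An operator is represented by the coefficient family of its normal form
  \<open>\<Sum>\<^sub>J a\<^sub>J D\<^sup>J\<close>, i.e. \<open>K[D]\<close> and \<open>K[X]\<close> share the same additive group. They differ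
  in the multiplication: on \<open>mpoly\<close> it is the commutative \<^term>\<open>(*)\<close> of the library, on
  \<open>lpdo\<close> it is \<open>lpdo_comp \<delta>\<close> below.
\<close>

type_synonym ('n, 'a) mpoly = "('n \<Rightarrow>\<^sub>0 nat) \<Rightarrow>\<^sub>0 'a"
type_synonym ('n, 'a) lpdo = "('n \<Rightarrow>\<^sub>0 nat) \<Rightarrow>\<^sub>0 'a"

text \<open>
  \<open>D\<^sub>i \<circ> \<Sum>\<^sub>J b\<^sub>J D\<^sup>J = \<Sum>\<^sub>J b\<^sub>J D\<^sub>i D\<^sup>J + \<Sum>\<^sub>J \<partial>\<^sub>i(b\<^sub>J) D\<^sup>J\<close>; the first sum is the
  shift of exponents effected by the commutative product with the variable.
\<close>

definition D_comp ::
  "('n \<Rightarrow> 'a::field_char_0 \<Rightarrow> 'a) \<Rightarrow> 'n \<Rightarrow> ('n, 'a) lpdo \<Rightarrow> ('n, 'a) lpdo" where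
  "D_comp \<delta> i Q = Poly_Mapping.single (Poly_Mapping.single i 1) 1 * Q + Poly_Mapping.map (\<delta> i) Q"

text \<open>\<open>D\<^sup>J \<circ> Q\<close>\<close>

definition Dpow_comp ::
  "('n::{finite,linorder} \<Rightarrow> 'a::field_char_0 \<Rightarrow> 'a) \<Rightarrow> ('n \<Rightarrow>\<^sub>0 nat) \<Rightarrow> ('n, 'a) lpdo \<Rightarrow> ('n, 'a) lpdo" where
  "Dpow_comp \<delta> J Q =
     foldr (\<lambda>i. D_comp \<delta> i ^^ Poly_Mapping.lookup J i) (sorted_list_of_set UNIV) Q"

text \<open>\<open>(\<Sum>\<^sub>J a\<^sub>J D\<^sup>J) \<circ> Q = \<Sum>\<^sub>J a\<^sub>J (D\<^sup>J \<circ> Q)\<close>\<close>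

definition lpdo_comp ::
  "('n::{finite,linorder} \<Rightarrow> 'a::field_char_0 \<Rightarrow> 'a) \<Rightarrow> ('n, 'a) lpdo \<Rightarrow> ('n, 'a) lpdo \<Rightarrow> ('n, 'a) lpdo" where
  "lpdo_comp \<delta> P Q =
     (\<Sum>J\<in>Poly_Mapping.keys P. Poly_Mapping.map ((*) (Poly_Mapping.lookup P J)) (Dpow_comp \<delta> J Q))"

definition mdeg :: "('n::finite \<Rightarrow>\<^sub>0 nat) \<Rightarrow> nat" where
  "mdeg J = (\<Sum>i\<in>UNIV. Poly_Mapping.lookup J i)"

text \<open>For a homogeneous polynomial, \<open>lpdo_ord\<close> is its degree (and \<open>-\<infinity>\<close> for 0).\<close>

definition lpdo_ord :: "(('n::finite \<Rightarrow>\<^sub>0 nat) \<Rightarrow>\<^sub>0 'a::zero) \<Rightarrow> ereal" where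
  "lpdo_ord L = (if L = 0 then -\<infinity> else ereal (real (Max (mdeg ` Poly_Mapping.keys L))))"

definition homogeneous :: "('n::finite, 'a::zero) mpoly \<Rightarrow> bool" where
  "homogeneous S \<longleftrightarrow> (\<exists>d. \<forall>J\<in>Poly_Mapping.keys S. mdeg J = d)"

definition Sym :: "('n::finite, 'a::field_char_0) lpdo \<Rightarrow> ('n, 'a) mpoly" where
  "Sym L = (\<Sum>J | J \<in> Poly_Mapping.keys L \<and> ereal (real (mdeg J)) = lpdo_ord L.
              Poly_Mapping.single J (Poly_Mapping.lookup L J))"

definition has_factorization_of_type ::
  "('n::{finite,linorder} \<Rightarrow> 'a::field_char_0 \<Rightarrow> 'a) \<Rightarrow> ('n, 'a) mpoly list \<Rightarrow> ('n, 'a) lpdo \<Rightarrow> bool" where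
  "has_factorization_of_type \<delta> Ss L \<longleftrightarrow>
     Sym L = prod_list Ss \<and> (\<exists>Fs. L = foldr (lpdo_comp \<delta>) Fs 1 \<and> map Sym Fs = Ss)"

text \<open>The types considered for \<open>A\<close> are those with \<open>Sym A = prod_list Ss\<close>.\<close>

definition common_obstacles ::
  "('n::{finite,linorder} \<Rightarrow> 'a::field_char_0 \<Rightarrow> 'a) \<Rightarrow> ('n, 'a) lpdo \<Rightarrow> ('n, 'a) mpoly list \<Rightarrow> ('n, 'a) lpdo set" where
  "common_obstacles \<delta> A Ss =
     {R. has_factorization_of_type \<delta> Ss (A - R) \<and>
         (\<forall>R'. has_factorization_of_type \<delta> Ss (A - R') \<longrightarrow> lpdo_ord R \<le> lpdo_ord R')}"

text \<open>
  The remainder checks that \<open>lpdo_comp \<delta>\<close> is the multiplication of \<open>K[D]\<close>: it makes the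
  operators a ring with unit 1, extends the multiplication of \<open>K\<close> and satisfies the defining
  relations, and every operator is \<open>\<Sum>\<^sub>J a\<^sub>J D\<^sup>J\<close>.
\<close>

abbreviation Dop :: "'n \<Rightarrow> ('n, 'a::field_char_0) lpdo" where
  "Dop i \<equiv> Poly_Mapping.single (Poly_Mapping.single i 1) 1"

abbreviation Kop :: "'a \<Rightarrow> ('n, 'a::field_char_0) lpdo" where
  "Kop f \<equiv> Poly_Mapping.single 0 f"

lemma lpdo_induct [case_names zero single add]:
  assumes "Pr 0" "\<And>J a. Pr (Poly_Mapping.single J a)" "\<And>P Q. Pr P \<Longrightarrow> Pr Q \<Longrightarrow> Pr (P + Q)"
  shows "Pr (P :: 'm \<Rightarrow>\<^sub>0 'c::comm_monoid_add)"
proof -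
  have "P = (\<Sum>J\<in>Poly_Mapping.keys P. Poly_Mapping.single J (Poly_Mapping.lookup P J))"
    by (rule poly_mapping_eqI) (auto simp: lookup_sum lookup_single when_def in_keys_iff)
  moreover have "Pr (\<Sum>J\<in>X. Poly_Mapping.single J (Poly_Mapping.lookup P J))" if "finite X" for X
    using that by (induction X rule: finite_induct) (auto intro: assms)
  ultimately show ?thesis by (metis finite_keys)
qed

context commuting_derivations
begin

lemma deriv_0 [simp]: "\<delta> i 0 = 0"
  using deriv_add[of i 0 0] by simp

lemma deriv_1 [simp]: "\<delta> i 1 = 0"
  using deriv_mult[of i 1 1] by simp

lemma lookup_map_deriv [simp]:
  "Poly_Mapping.lookup (Poly_Mapping.map (\<delta> i) Q) J = \<delta> i (Poly_Mapping.lookup Q J)"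
  by (simp add: Poly_Mapping.map.rep_eq when_def)

lemma map_deriv_0 [simp]: "Poly_Mapping.map (\<delta> i) 0 = 0"
  by (rule poly_mapping_eqI) simp

lemma map_deriv_add: "Poly_Mapping.map (\<delta> i) (P + Q) = Poly_Mapping.map (\<delta> i) P + Poly_Mapping.map (\<delta> i) Q"
  by (rule poly_mapping_eqI) (simp add: lookup_add deriv_add)

lemma map_deriv_mult:
  "Poly_Mapping.map (\<delta> i) (P * Q) = Poly_Mapping.map (\<delta> i) P * Q + P * Poly_Mapping.map (\<delta> i) Q"
proof (induction P rule: lpdo_induct)
  case zero
  show ?case by simp
next
  case (add P P')
  then show ?case by (simp add: algebra_simps map_deriv_add)
next
  case (single J a)
  show ?case
  proof (induction Q rule: lpdo_induct)
    case zero
    show ?case by simp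
  next
    case (add P P')
    then show ?case by (simp add: algebra_simps map_deriv_add)
  next
    case (single J' b)
    show ?case
      by (simp add: mult_single deriv_mult single_add)
  qed
qed

lemma D_comp_add: "D_comp \<delta> i (P + Q) = D_comp \<delta> i P + D_comp \<delta> i Q"
  by (simp add: D_comp_def map_deriv_add algebra_simps)

lemma D_comp_0 [simp]: "D_comp \<delta> i 0 = 0"
  using D_comp_add[of i 0 0] by simp

lemma D_comp_Kop: "D_comp \<delta> i (Kop f * Q) = Kop f * D_comp \<delta> i Q + Kop (\<delta> i f) * Q"
  by (simp add: D_comp_def map_deriv_mult algebra_simps)

lemma D_comp_commute: "D_comp \<delta> i (D_comp \<delta> j Q) = D_comp \<delta> j (D_comp \<delta> i Q)"
proof -
  have "Poly_Mapping.map (\<delta> i) (Poly_Mapping.map (\<delta> j) Q) = Poly_Mapping.map (\<delta> j) (Poly_Mapping.map (\<delta> i) Q)"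
    by (rule poly_mapping_eqI) (simp add: deriv_commute)
  then show ?thesis
    by (simp add: D_comp_def map_deriv_mult map_deriv_add algebra_simps)
qed

lemma D_comp_power_commute: "D_comp \<delta> i ((D_comp \<delta> j ^^ m) Q) = (D_comp \<delta> j ^^ m) (D_comp \<delta> i Q)"
  by (induction m) (simp_all, metis D_comp_commute)

lemma D_comp_power_add: "(D_comp \<delta> j ^^ m) (P + Q) = (D_comp \<delta> j ^^ m) P + (D_comp \<delta> j ^^ m) Q"
  by (induction m) (simp_all add: D_comp_add)

lemma Dpow_comp_add: "Dpow_comp \<delta> J (P + Q) = Dpow_comp \<delta> J P + Dpow_comp \<delta> J Q"
proof -
  have "foldr (\<lambda>i. D_comp \<delta> i ^^ Poly_Mapping.lookup J i) xs (P + Q)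
      = foldr (\<lambda>i. D_comp \<delta> i ^^ Poly_Mapping.lookup J i) xs P
      + foldr (\<lambda>i. D_comp \<delta> i ^^ Poly_Mapping.lookup J i) xs Q" for xs
    by (induction xs) (simp_all add: D_comp_power_add)
  then show ?thesis by (simp add: Dpow_comp_def)
qed

lemma Dpow_comp_0 [simp]: "Dpow_comp \<delta> J 0 = 0"
  using Dpow_comp_add[of J 0 0] by simp

lemma Dpow_comp_zero [simp]: "Dpow_comp \<delta> 0 Q = Q"
proof -
  have "foldr (\<lambda>i. D_comp \<delta> i ^^ Poly_Mapping.lookup 0 i) xs Q = Q" for xs
    by (induction xs) simp_all
  then show ?thesis by (simp add: Dpow_comp_def)
qed

lemma Dpow_comp_Suc:
  "Dpow_comp \<delta> (Poly_Mapping.single i 1 + J) Q = D_comp \<delta> i (Dpow_comp \<delta> J Q)"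
proof -
  let ?f = "\<lambda>J i. D_comp \<delta> i ^^ Poly_Mapping.lookup J i"
  have *: "foldr (?f (Poly_Mapping.single i 1 + J)) xs Q = foldr (?f J) xs Q" if "i \<notin> set xs" for xs
    using that by (induction xs) (auto simp: lookup_add lookup_single)
  have "foldr (?f (Poly_Mapping.single i 1 + J)) xs Q = D_comp \<delta> i (foldr (?f J) xs Q)"
    if "distinct xs" "i \<in> set xs" for xs
    using that
  proof (induction xs)
    case (Cons x xs)
    then show ?case
      using * by (cases "x = i") (auto simp: lookup_add lookup_single D_comp_power_commute)
  qed simp
  then show ?thesis by (simp add: Dpow_comp_def)
qed

lemma comp_alt: "lpdo_comp \<delta> P Q = (\<Sum>J\<in>X. Kop (Poly_Mapping.lookup P J) * Dpow_comp \<delta> J Q)"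
  if "finite X" "Poly_Mapping.keys P \<subseteq> X"
  unfolding lpdo_comp_def mult_map_scale_conv_mult
  by (rule sum.mono_neutral_left) (use that in \<open>auto simp: in_keys_iff\<close>)

lemma comp_0_left [simp]: "lpdo_comp \<delta> 0 Q = 0"
  by (simp add: lpdo_comp_def)

lemma comp_0_right [simp]: "lpdo_comp \<delta> P 0 = 0"
  by (subst comp_alt[OF finite_keys order_refl]) simp

lemma comp_add_left: "lpdo_comp \<delta> (P + P') Q = lpdo_comp \<delta> P Q + lpdo_comp \<delta> P' Q"
proof -
  let ?X = "Poly_Mapping.keys P \<union> Poly_Mapping.keys P'"
  have "Poly_Mapping.keys (P + P') \<subseteq> ?X" by (rule Poly_Mapping.keys_add)
  then show ?thesis
    using comp_alt[of ?X "P + P'"] comp_alt[of ?X P] comp_alt[of ?X P']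
    by (simp add: lookup_add single_add algebra_simps sum.distrib)
qed

lemma comp_add_right: "lpdo_comp \<delta> P (Q + Q') = lpdo_comp \<delta> P Q + lpdo_comp \<delta> P Q'"
  by (simp add: comp_alt[OF finite_keys order_refl] Dpow_comp_add algebra_simps sum.distrib)

lemma comp_single: "lpdo_comp \<delta> (Poly_Mapping.single J a) Q = Kop a * Dpow_comp \<delta> J Q"
  by (subst comp_alt[of "{J}"]) auto

lemma comp_Kop: "lpdo_comp \<delta> (Kop a) Q = Kop a * Q"
  by (simp add: comp_single)

lemma comp_Dop: "lpdo_comp \<delta> (Dop i) Q = D_comp \<delta> i Q"
  using Dpow_comp_Suc[of i 0 Q] by (simp add: comp_single)

theorem D_Kop_relation: "lpdo_comp \<delta> (Dop i) (Kop f) = lpdo_comp \<delta> (Kop f) (Dop i) + Kop (\<delta> i f)"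
  unfolding comp_Dop comp_Kop by (simp add: D_comp_def mult_single)

theorem Kop_hom: "lpdo_comp \<delta> (Kop f) (Kop g) = Kop (f * g)"
  by (simp add: comp_Kop mult_single)

theorem D_commute: "lpdo_comp \<delta> (Dop i) (Dop j) = lpdo_comp \<delta> (Dop j) (Dop i)"
  unfolding comp_Dop by (simp add: D_comp_def mult_single add.commute)

theorem comp_1_left: "lpdo_comp \<delta> 1 Q = Q"
  using comp_Kop[of 1 Q] by simp

lemma comp_Kop_mult: "lpdo_comp \<delta> (Kop a * P) Q = Kop a * lpdo_comp \<delta> P Q"
proof (induction P rule: lpdo_induct)
  case (single J b)
  show ?case by (simp add: mult_single comp_single flip: mult.assoc)
qed (simp_all add: algebra_simps comp_add_left)

lemma comp_D_comp: "lpdo_comp \<delta> (D_comp \<delta> i P) Q = D_comp \<delta> i (lpdo_comp \<delta> P Q)"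
proof (induction P rule: lpdo_induct)
  case (single J b)
  have "D_comp \<delta> i (Poly_Mapping.single J b)
      = Poly_Mapping.single (Poly_Mapping.single i 1 + J) b + Poly_Mapping.single J (\<delta> i b)"
    by (simp add: D_comp_def mult_single)
  then show ?case
    by (simp add: comp_add_left comp_single Dpow_comp_Suc[simplified] D_comp_Kop)
qed (simp_all add: comp_add_left D_comp_add)

lemma comp_Dpow_comp: "lpdo_comp \<delta> (Dpow_comp \<delta> J P) Q = Dpow_comp \<delta> J (lpdo_comp \<delta> P Q)"
proof -
  have *: "lpdo_comp \<delta> ((D_comp \<delta> i ^^ m) P) Q = (D_comp \<delta> i ^^ m) (lpdo_comp \<delta> P Q)" for i m P
    by (induction m) (simp_all add: comp_D_comp)
  have "lpdo_comp \<delta> (foldr (\<lambda>i. D_comp \<delta> i ^^ Poly_Mapping.lookup J i) xs P) Q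
      = foldr (\<lambda>i. D_comp \<delta> i ^^ Poly_Mapping.lookup J i) xs (lpdo_comp \<delta> P Q)" for xs
    by (induction xs) (simp_all add: *)
  then show ?thesis by (simp add: Dpow_comp_def)
qed

theorem comp_assoc: "lpdo_comp \<delta> (lpdo_comp \<delta> P Q) R = lpdo_comp \<delta> P (lpdo_comp \<delta> Q R)"
proof (induction P rule: lpdo_induct)
  case (single J a)
  show ?case by (simp add: comp_single comp_Kop_mult comp_Dpow_comp)
qed (simp_all add: comp_add_left)

lemma Dpow_comp_1: "Dpow_comp \<delta> J 1 = Poly_Mapping.single J 1"
proof -
  have *: "(D_comp \<delta> i ^^ m) (Poly_Mapping.single J 1) = Poly_Mapping.single (Poly_Mapping.single i m + J) 1"
    for i m J
  proof (induction m)
    case (Suc m)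
    have "Poly_Mapping.single i (1::nat) + Poly_Mapping.single i m = Poly_Mapping.single i (Suc m)"
      by (simp flip: single_add)
    with Suc show ?case by (simp add: D_comp_def mult_single flip: add.assoc)
  qed simp
  have "foldr (\<lambda>i. D_comp \<delta> i ^^ Poly_Mapping.lookup J i) xs (Poly_Mapping.single 0 1)
      = Poly_Mapping.single (\<Sum>i\<leftarrow>xs. Poly_Mapping.single i (Poly_Mapping.lookup J i)) 1" for xs
    by (induction xs) (simp_all add: * del: single_one)
  moreover have "(\<Sum>i\<leftarrow>sorted_list_of_set UNIV. Poly_Mapping.single i (Poly_Mapping.lookup J i)) = J"
    by (subst sum_list_distinct_conv_sum_set)
      (auto intro!: poly_mapping_eqI simp: lookup_sum lookup_single when_def)
  ultimately show ?thesis by (simp add: Dpow_comp_def)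
qed

theorem comp_1_right: "lpdo_comp \<delta> P 1 = P"
proof (induction P rule: lpdo_induct)
  case (single J a)
  show ?case by (simp add: comp_single Dpow_comp_1 mult_single)
qed (simp_all add: comp_add_left)

end

end

theory Submission
  imports Defs "HOL-Computational_Algebra.Factorial_Ring"
begin

text \<open>
  A factorization of type \<open>(S1)(S2)(S3)\<close> becomes one of type \<open>(S1 S2)(S3)\<close> by multiplying out the
  first two factors. So \<open>V = W\<close> follows, by comparing minimal orders, as soon as every obstacle
  \<open>R\<close> in \<open>V\<close> also admits the finer factorization: if \<open>A - R = G12 \<circ> G3\<close>, then \<open>G12\<close> has to split
  as \<open>F \<circ> H\<close> with symbols \<open>S1\<close> and \<open>S2\<close>.

  The left factor \<open>F\<close> comes from an obstacle \<open>R'\<close> in \<open>U\<close>, that is from \<open>A - R' = F \<circ> E\<close>.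
  Subtracting the two equations gives \<open>G12 \<circ> G3 + (R - R') = F \<circ> E\<close>, where \<open>R - R'\<close> has order less
  than \<open>G3\<close>. Division of \<open>G12\<close> by \<open>F\<close> on the left now comes out exactly: as long as a nonzero
  remainder \<open>T\<close> is left, \<open>T \<circ> G3\<close> agrees with a left multiple of \<open>F\<close> up to order less than that
  of \<open>G3\<close>, hence \<open>Sym T * S3\<close> is a multiple of \<open>S1\<close>. As \<open>S1\<close> and \<open>S3\<close> are coprime, \<open>S1\<close> divides
  \<open>Sym T\<close>, and the division can be continued (lemmas \<open>left_divisible_of_product\<close> and
  \<open>left_factor_splits_off\<close>).

  Two ingredients are needed. Symbols are multiplicative (\<open>Sym_comp\<close>), because composition agrees
  with commutative multiplication up to terms of lower order. And \<open>K[X]\<close> has unique factorization,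
  in the form that \<open>a dvd b * c\<close> implies \<open>a dvd b\<close> if \<open>a\<close> and \<open>c\<close> have only units as common
  divisors (\<open>coprime_dvd_mult_imp_dvd\<close>). The latter is proved by induction over the set of
  variables. When a variable \<open>x\<close> is added, irreducible elements free of \<open>x\<close> stay prime by Gauss's
  lemma (\<open>prime_in_extension\<close>), and for those that involve \<open>x\<close> pseudo-division takes the place of
  Euclidean division over the fraction field (\<open>prime_of_new_variable\<close>).
\<close>

section \<open>Weights on exponents\<close>

text \<open>
  A weight is an additive map from exponents to the naturals. Two kinds of weight occur: the
  total degree, which governs orders and symbols of operators, and the degree in one fixed
  variable, which governs the induction over the number of variables. Degrees enter only through
  the bounds \<open>below\<close>, which are strict: 0 lies below every bound, below 0 there is nothing
  else, and an induction on the bound needs no convention for the degree of 0.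
\<close>

definition homog :: "('b \<Rightarrow> nat) \<Rightarrow> nat \<Rightarrow> ('b \<Rightarrow>\<^sub>0 'c::zero) \<Rightarrow> bool" where
  "homog w k p \<longleftrightarrow> (\<forall>J\<in>Poly_Mapping.keys p. w J = k)"

definition below :: "('b \<Rightarrow> nat) \<Rightarrow> nat \<Rightarrow> ('b \<Rightarrow>\<^sub>0 'c::zero) \<Rightarrow> bool" where
  "below w k p \<longleftrightarrow> (\<forall>J\<in>Poly_Mapping.keys p. w J < k)"

definition part :: "('b \<Rightarrow> nat) \<Rightarrow> nat \<Rightarrow> ('b \<Rightarrow>\<^sub>0 'c::comm_monoid_add) \<Rightarrow> ('b \<Rightarrow>\<^sub>0 'c)" where
  "part w k p = (\<Sum>J | J \<in> Poly_Mapping.keys p \<and> w J = k. Poly_Mapping.single J (Poly_Mapping.lookup p J))"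

lemma lookup_part: "Poly_Mapping.lookup (part w k p) J = (if w J = k then Poly_Mapping.lookup p J else 0)"
  by (auto simp: part_def lookup_sum lookup_single when_def in_keys_iff)

lemma part_add: "part w k (p + q) = part w k p + part w k q"
  by (rule poly_mapping_eqI) (simp add: lookup_part lookup_add)

lemma part_0 [simp]: "part w k 0 = 0"
  by (rule poly_mapping_eqI) (simp add: lookup_part)

lemma homog_part: "homog w k (part w k p)"
  by (auto simp: homog_def in_keys_iff lookup_part split: if_splits)

lemma part_homog: "homog w k p \<Longrightarrow> part w j p = (if j = k then p else 0)"
  by (rule poly_mapping_eqI) (auto simp: homog_def in_keys_iff lookup_part)

lemma below_part: "below v m p \<Longrightarrow> below v m (part w k p)"
  by (auto simp: below_def in_keys_iff lookup_part split: if_splits)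

lemma part_below: "below w k p \<Longrightarrow> part w k p = 0"
  by (rule poly_mapping_eqI) (auto simp: below_def in_keys_iff lookup_part)

lemma below_zero [simp]: "below w m 0"
  by (simp add: below_def)

lemma below_0_iff [simp]: "below w 0 p \<longleftrightarrow> p = 0"
  by (auto simp: below_def simp flip: keys_eq_empty)

lemma below_mono: "below w m p \<Longrightarrow> m \<le> n \<Longrightarrow> below w n p"
  by (auto simp: below_def)

lemma part_nonzero_less: "part w k p \<noteq> 0 \<Longrightarrow> below w m p \<Longrightarrow> k < m"
  by (meson below_mono not_less part_below)

lemma below_add: "below w m p \<Longrightarrow> below w m q \<Longrightarrow> below w m (p + q)"
  unfolding below_def using Poly_Mapping.keys_add[of p q] by blast

lemma below_diff: "below w m p \<Longrightarrow> below w m q \<Longrightarrow> below w m (p - q :: _ \<Rightarrow>\<^sub>0 _::ab_group_add)"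
  unfolding below_def using keys_diff[of p q] by blast

lemma below_sum: "(\<And>x. x \<in> X \<Longrightarrow> below w m (f x)) \<Longrightarrow> below w m (sum f X)"
  by (induction X rule: infinite_finite_induct) (auto intro: below_add)

lemma homog_below: "homog w k p \<Longrightarrow> below w (Suc k) p"
  by (auto simp: homog_def below_def)

lemma top_part_exists:
  assumes "p \<noteq> 0"
  obtains k where "part w k p \<noteq> 0" "below w (Suc k) p"
proof -
  let ?k = "Max (w ` Poly_Mapping.keys p)"
  have ne: "Poly_Mapping.keys p \<noteq> {}" using assms by simp
  then obtain J where "J \<in> Poly_Mapping.keys p" "w J = ?k"
    using Max_in[of "w ` Poly_Mapping.keys p"] by (metis (no_types, lifting) finite_imageI finite_keys image_iff image_is_empty)
  then have "Poly_Mapping.lookup (part w ?k p) J \<noteq> 0" by (simp add: lookup_part in_keys_iff)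
  then have "part w ?k p \<noteq> 0" by auto
  moreover have "below w (Suc ?k) p" by (auto simp: below_def less_Suc_eq_le)
  ultimately show ?thesis using that by blast
qed

lemma below_exists: "\<exists>k. below w k p"
  by (rule exI[of _ "Suc (Max (w ` Poly_Mapping.keys p))"]) (auto simp: below_def less_Suc_eq_le)

lemma below_minus_part:
  fixes p :: "'b \<Rightarrow>\<^sub>0 'c::ab_group_add"
  shows "below w (Suc k) p \<Longrightarrow> below w k (p - part w k p)"
  by (auto simp: below_def in_keys_iff lookup_minus lookup_part less_Suc_eq split: if_splits)

locale weight =
  fixes w :: "'b::{ordered_cancel_comm_monoid_add, linorder} \<Rightarrow> nat"
  assumes w_add: "w (J + J') = w J + w J'"
begin

lemma homog_mult:
  fixes p q :: "'b \<Rightarrow>\<^sub>0 'c::comm_ring_1"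
  assumes "homog w k p" "homog w l q"
  shows "homog w (k + l) (p * q)"
  unfolding homog_def
proof
  fix J assume "J \<in> Poly_Mapping.keys (p * q)"
  then obtain a b where "J = a + b" "a \<in> Poly_Mapping.keys p" "b \<in> Poly_Mapping.keys q"
    using keys_mult[of p q] by blast
  with assms show "w J = k + l" by (simp add: homog_def w_add)
qed

lemma below_mult:
  fixes p q :: "'b \<Rightarrow>\<^sub>0 'c::comm_ring_1"
  assumes "below w m p" "below w (Suc n) q"
  shows "below w (m + n) (p * q)"
  unfolding below_def
proof
  fix J assume "J \<in> Poly_Mapping.keys (p * q)"
  then obtain a b where "J = a + b" "a \<in> Poly_Mapping.keys p" "b \<in> Poly_Mapping.keys q"
    using keys_mult[of p q] by blast
  moreover from this assms have "w a < m" "w b < Suc n" by (auto simp: below_def)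
  ultimately show "w J < m + n" by (simp add: w_add)
qed

lemma part_homog_mult:
  fixes p q :: "'b \<Rightarrow>\<^sub>0 'c::comm_ring_1"
  assumes "homog w d p"
  shows "part w (d + k) (p * q) = p * part w k q"
proof (induction q rule: lpdo_induct)
  case (single J a)
  have J: "homog w (w J) (Poly_Mapping.single J a)" by (simp add: homog_def)
  show ?case
    using part_homog[OF homog_mult[OF assms J], of "d + k"] part_homog[OF J, of k] by simp
qed (simp_all add: part_add algebra_simps)

text \<open>
  Only the top pieces of the factors reach the top weight of the product. Over a domain this
  makes degrees additive.
\<close>

lemma part_top_mult:
  fixes p q :: "'b \<Rightarrow>\<^sub>0 'c::comm_ring_1"
  assumes p: "below w (Suc m) p" and q: "below w (Suc n) q"
  shows "part w (m + n) (p * q) = part w m p * part w n q"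
proof -
  let ?p = "p - part w m p"
  have "p * q = part w m p * q + ?p * q" by (simp add: algebra_simps)
  moreover have "part w (m + n) (?p * q) = 0"
    by (rule part_below, rule below_mult[OF below_minus_part[OF p] q])
  ultimately show ?thesis by (simp add: part_add part_homog_mult[OF homog_part])
qed

lemma below_factor:
  fixes p q :: "'b \<Rightarrow>\<^sub>0 'c::idom"
  assumes pq: "below w m (p * q)" and nz: "p * q \<noteq> 0"
  obtains k l where "below w (Suc k) p" "below w (Suc l) q" "k + l < m"
proof -
  have "p \<noteq> 0" "q \<noteq> 0" using nz by (metis mult_zero_left, metis mult_zero_right)
  obtain k where k: "part w k p \<noteq> 0" "below w (Suc k) p"
    using top_part_exists[OF \<open>p \<noteq> 0\<close>] .
  obtain l where l: "part w l q \<noteq> 0" "below w (Suc l) q"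
    using top_part_exists[OF \<open>q \<noteq> 0\<close>] .
  have "part w k p * part w l q \<noteq> 0" using k(1) l(1) by (rule no_zero_divisors)
  then have "part w (k + l) (p * q) \<noteq> 0"
    by (simp only: part_top_mult[OF k(2) l(2)] not_False_eq_True)
  from part_nonzero_less[OF this pq] show ?thesis by (rule that[OF k(2) l(2)])
qed

end

section \<open>Unique factorization in multivariate polynomial rings\<close>

lemma weight_lookup: "weight (\<lambda>J :: 'n::linorder \<Rightarrow>\<^sub>0 nat. Poly_Mapping.lookup J i)"
  by unfold_locales (simp add: lookup_add)

lemma weight_mdeg: "weight (mdeg :: ('n::{finite,linorder} \<Rightarrow>\<^sub>0 nat) \<Rightarrow> nat)"
  by unfold_locales (simp add: mdeg_def lookup_add sum.distrib)

interpretation deg: weight "mdeg :: ('n::{finite,linorder} \<Rightarrow>\<^sub>0 nat) \<Rightarrow> nat"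
  by (rule weight_mdeg)

interpretation var: weight "\<lambda>J :: 'n::linorder \<Rightarrow>\<^sub>0 nat. Poly_Mapping.lookup J i" for i
  by (rule weight_lookup)

text \<open>
  The subring \<open>K[X]\<close> of polynomials in the variables from \<open>X\<close>. It is a predicate on one
  ambient ring, and not a type of its own, so that an induction over \<open>X\<close> can be stated.
\<close>

definition vars_in :: "'n set \<Rightarrow> (('n \<Rightarrow>\<^sub>0 nat) \<Rightarrow>\<^sub>0 'a::zero) \<Rightarrow> bool" where
  "vars_in X p \<longleftrightarrow> (\<forall>i. i \<notin> X \<longrightarrow> below (\<lambda>J. Poly_Mapping.lookup J i) 1 p)"

lemma vars_in_UNIV [simp]: "vars_in UNIV p"
  by (simp add: vars_in_def)

lemma vars_in_0 [simp]: "vars_in X 0"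
  by (simp add: vars_in_def)

lemma vars_in_1 [simp]: "vars_in X (1 :: ('n \<Rightarrow>\<^sub>0 nat) \<Rightarrow>\<^sub>0 'a::zero_neq_one)"
  by (simp add: vars_in_def below_def)

lemma vars_in_mono: "vars_in X p \<Longrightarrow> X \<subseteq> Y \<Longrightarrow> vars_in Y p"
  by (auto simp: vars_in_def)

lemma vars_in_add: "vars_in X p \<Longrightarrow> vars_in X q \<Longrightarrow> vars_in X (p + q)"
  by (auto simp: vars_in_def intro: below_add)

lemma vars_in_diff: "vars_in X p \<Longrightarrow> vars_in X q \<Longrightarrow> vars_in X (p - q :: _ \<Rightarrow>\<^sub>0 _::ab_group_add)"
  by (auto simp: vars_in_def intro: below_diff)

lemma vars_in_part: "vars_in X p \<Longrightarrow> vars_in X (part w k p)"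
  unfolding vars_in_def by (intro allI impI below_part) simp

lemma vars_in_mult:
  fixes p q :: "('n::linorder \<Rightarrow>\<^sub>0 nat) \<Rightarrow>\<^sub>0 'a::comm_ring_1"
  shows "vars_in X p \<Longrightarrow> vars_in X q \<Longrightarrow> vars_in X (p * q)"
  using var.below_mult[of _ 1 p 0 q] by (auto simp: vars_in_def)

text \<open>
  Degrees in each variable are additive. Because of this lemma, divisibility, units and
  irreducibility in \<open>K[X]\<close> agree with those of the ambient ring.
\<close>

lemma vars_in_factor:
  fixes p q :: "('n::linorder \<Rightarrow>\<^sub>0 nat) \<Rightarrow>\<^sub>0 'a::idom"
  assumes "vars_in X (p * q)" "p * q \<noteq> 0"
  shows "vars_in X p" "vars_in X q"
proof -
  have "below (\<lambda>J. Poly_Mapping.lookup J i) 1 p \<and> below (\<lambda>J. Poly_Mapping.lookup J i) 1 q"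
    if "i \<notin> X" for i
  proof -
    have "below (\<lambda>J. Poly_Mapping.lookup J i) 1 (p * q)" using assms(1) that by (simp add: vars_in_def)
    from var.below_factor[OF this assms(2)] obtain k l where
      "below (\<lambda>J. Poly_Mapping.lookup J i) (Suc k) p" "below (\<lambda>J. Poly_Mapping.lookup J i) (Suc l) q" "k + l < 1" .
    then show ?thesis by simp
  qed
  then show "vars_in X p" "vars_in X q" by (auto simp: vars_in_def)
qed

lemma vars_in_empty_unit:
  fixes p :: "('n::linorder \<Rightarrow>\<^sub>0 nat) \<Rightarrow>\<^sub>0 'a::field"
  assumes "vars_in {} p" "p \<noteq> 0"
  shows "p dvd 1"
proof -
  have keys: "J = 0" if "J \<in> Poly_Mapping.keys p" for J
    using assms(1) that by (intro poly_mapping_eqI) (auto simp: vars_in_def below_def)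
  define c where "c = Poly_Mapping.lookup p 0"
  have p: "p = Poly_Mapping.single 0 c"
    by (rule poly_mapping_eqI) (use keys in \<open>auto simp: c_def lookup_single when_def in_keys_iff\<close>)
  with assms(2) have "c \<noteq> 0" by auto
  then have "1 = p * Poly_Mapping.single 0 (inverse c)" by (simp add: p mult_single)
  then show ?thesis by (rule dvdI)
qed

lemma degree_0_unit:
  fixes p :: "('n::{finite,linorder} \<Rightarrow>\<^sub>0 nat) \<Rightarrow>\<^sub>0 'a::field"
  assumes "below mdeg 1 p" "p \<noteq> 0"
  shows "p dvd 1"
  by (rule vars_in_empty_unit[OF _ assms(2)])
    (use assms(1) in \<open>auto simp: vars_in_def below_def mdeg_def\<close>)

text \<open>
  A nonunit has positive degree, so splitting it off lowers the degree. Every descent along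
  divisors below terminates for this reason.
\<close>

lemma below_mdeg_cofactor:
  fixes p q :: "('n::{finite,linorder} \<Rightarrow>\<^sub>0 nat) \<Rightarrow>\<^sub>0 'a::field"
  assumes "below mdeg (Suc k) (p * q)" "p * q \<noteq> 0" "\<not> p dvd 1"
  shows "below mdeg k q"
proof -
  from deg.below_factor[OF assms(1,2)] obtain a b where
    ab: "below mdeg (Suc a) p" "below mdeg (Suc b) q" "a + b < Suc k" .
  have "p \<noteq> 0" using assms(2) by auto
  then have "\<not> below mdeg 1 p" using assms(3) degree_0_unit[of p] by auto
  then have "a \<noteq> 0" using ab(1) by (cases a) auto
  then show ?thesis using ab by (auto intro: below_mono)
qed

lemma irreducible_factor_exists:
  fixes p :: "('n::{finite,linorder} \<Rightarrow>\<^sub>0 nat) \<Rightarrow>\<^sub>0 'a::field"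
  assumes "p \<noteq> 0" "\<not> p dvd 1"
  shows "\<exists>r. irreducible r \<and> r dvd p"
proof -
  obtain k where "below mdeg k p" using below_exists[of mdeg p] by (rule exE)
  then show ?thesis using assms
  proof (induction k arbitrary: p)
    case (Suc k)
    show ?case
    proof (cases "irreducible p")
      case False
      then obtain a b where p: "p = a * b" and "\<not> a dvd 1" "\<not> b dvd 1"
        using Suc.prems(2,3) by (auto simp: irreducible_def)
      have "below mdeg k b"
        by (rule below_mdeg_cofactor[of k a b]) (use Suc.prems(1,2) p \<open>\<not> a dvd 1\<close> in simp_all)
      moreover have "b \<noteq> 0" using Suc.prems(2) p by auto
      ultimately obtain r where "irreducible r" "r dvd b"
        using Suc.IH[of b] \<open>\<not> b dvd 1\<close> by auto
      then show ?thesis unfolding p by (intro exI[of _ r]) (simp add: dvd_mult)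
    next
      case True
      then show ?thesis by (intro exI[of _ p]) simp
    qed
  qed simp
qed

text \<open>
  Irreducible elements of \<open>K[X]\<close> behave as primes on \<open>K[Y]\<close>. For \<open>Y = X\<close> this is the
  essential part of unique factorization; for \<open>Y\<close> with one variable more it is Gauss's lemma.
  The argument \<open>T\<close> names the field \<open>K\<close>, which the two sets do not determine.
\<close>

definition primes_within :: "'n::{finite,linorder} set \<Rightarrow> 'n set \<Rightarrow> 'a::field itself \<Rightarrow> bool" where
  "primes_within X Y T \<longleftrightarrow> (\<forall>r a b :: ('n \<Rightarrow>\<^sub>0 nat) \<Rightarrow>\<^sub>0 'a.
     irreducible r \<longrightarrow> vars_in X r \<longrightarrow> vars_in Y a \<longrightarrow> vars_in Y b \<longrightarrow> r dvd a * b \<longrightarrow> r dvd a \<or> r dvd b)"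

text \<open>
  The prime factors of \<open>c\<close> divide \<open>q * r\<close>, so each of them can be moved into \<open>q\<close> or \<open>r\<close>.
  This replaces computing over the fraction field of \<open>K[X]\<close> and clearing denominators.
\<close>

lemma distribute_factor:
  fixes c p q r :: "('n::{finite,linorder} \<Rightarrow>\<^sub>0 nat) \<Rightarrow>\<^sub>0 'a::field"
  assumes prime: "primes_within X Y TYPE('a)" and XY: "X \<subseteq> Y"
    and "vars_in X c" "c \<noteq> 0" "vars_in Y p" "p \<noteq> 0" "c * p = q * r"
  shows "\<exists>c1 c2 q' r'. c = c1 * c2 \<and> q = c1 * q' \<and> r = c2 * r' \<and> p = q' * r'"
proof -
  obtain k where "below mdeg k c" using below_exists[of mdeg c] by (rule exE)
  then show ?thesis using assms(3-)
  proof (induction k arbitrary: c q r)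
    case (Suc k)
    show ?case
    proof (cases "c dvd 1")
      case True
      then obtain d where d: "1 = c * d" by (elim dvdE)
      have "p = (c * p) * d" using d by (simp add: mult_ac flip: mult.assoc[of c d])
      then have "p = (d * q) * r" unfolding Suc.prems(6) by (simp add: mult_ac)
      moreover have "q = c * (d * q)" using d by (simp flip: mult.assoc)
      ultimately show ?thesis by (intro exI[of _ c] exI[of _ 1] exI[of _ "d * q"] exI[of _ r]) simp
    next
      case False
      then obtain s where s: "irreducible s" "s dvd c"
        using irreducible_factor_exists[OF \<open>c \<noteq> 0\<close>] by blast
      then obtain e where e: "c = s * e" by blast
      have e0: "s \<noteq> 0" "e \<noteq> 0" using e Suc.prems by auto
      have sX: "vars_in X s" "vars_in X e" using vars_in_factor[of X s e] e Suc.prems by auto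
      have be: "below mdeg k e"
        using below_mdeg_cofactor[of k s e] s e Suc.prems irreducible_not_unit by auto
      have "vars_in Y (q * r)" "q * r \<noteq> 0"
        using vars_in_mult[OF vars_in_mono[OF Suc.prems(2) XY] Suc.prems(4)] Suc.prems(3,5)
        unfolding Suc.prems(6)[symmetric] by simp_all
      then have Y: "vars_in Y q" "vars_in Y r" using vars_in_factor[of Y q r] by auto
      have "s dvd q * r" unfolding Suc.prems(6)[symmetric] e by simp
      then consider "s dvd q" | "s dvd r"
        using prime s sX Y unfolding primes_within_def by blast
      then show ?thesis
      proof cases
        case 1
        then obtain q1 where q1: "q = s * q1" by blast
        have "s * (e * p) = s * (q1 * r)" using Suc.prems(6) e q1 by (simp add: mult.assoc)
        then have "e * p = q1 * r" using e0 by simp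
        from Suc.IH[OF be sX(2) e0(2) Suc.prems(4,5) this] obtain c1 c2 q' r' where
          "e = c1 * c2" "q1 = c1 * q'" "r = c2 * r'" "p = q' * r'" by (elim exE conjE)
        then show ?thesis
          unfolding e q1 by (intro exI[of _ "s * c1"] exI[of _ c2] exI[of _ q'] exI[of _ r']) (simp add: mult_ac)
      next
        case 2
        then obtain r1 where r1: "r = s * r1" by blast
        have "s * (e * p) = s * (q * r1)" using Suc.prems(6) e r1 by (simp add: mult_ac)
        then have "e * p = q * r1" using e0 by simp
        from Suc.IH[OF be sX(2) e0(2) Suc.prems(4,5) this] obtain c1 c2 q' r' where
          "e = c1 * c2" "q = c1 * q'" "r1 = c2 * r'" "p = q' * r'" by (elim exE conjE)
        then show ?thesis
          unfolding e r1 by (intro exI[of _ c1] exI[of _ "s * c2"] exI[of _ q'] exI[of _ r']) (simp add: mult_ac)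
      qed
    qed
  qed simp
qed

abbreviation xpow :: "'n \<Rightarrow> nat \<Rightarrow> ('n \<Rightarrow>\<^sub>0 nat) \<Rightarrow>\<^sub>0 'a::{zero,one}" where
  "xpow x k \<equiv> Poly_Mapping.single (Poly_Mapping.single x k) 1"

lemma part_eq_coeff_times_power:
  fixes f :: "('n::linorder \<Rightarrow>\<^sub>0 nat) \<Rightarrow>\<^sub>0 'a::comm_ring_1"
  assumes "vars_in (insert x X) f"
  obtains c where "vars_in X c" "part (\<lambda>J. Poly_Mapping.lookup J x) k f = c * xpow x k"
proof -
  let ?p = "part (\<lambda>J. Poly_Mapping.lookup J x) k f"
  let ?c = "\<Sum>J\<in>Poly_Mapping.keys ?p. Poly_Mapping.single (J - Poly_Mapping.single x k) (Poly_Mapping.lookup ?p J)"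
  have J1: "Poly_Mapping.lookup J x = k" if "J \<in> Poly_Mapping.keys ?p" for J
    using that homog_part[of "\<lambda>J. Poly_Mapping.lookup J x" k f] unfolding homog_def by blast
  have J2: "Poly_Mapping.lookup J i = 0" if "J \<in> Poly_Mapping.keys ?p" "i \<notin> insert x X" for J i
    using that vars_in_part[OF assms, of _ k] unfolding vars_in_def below_def less_one by blast
  have "?p = (\<Sum>J\<in>Poly_Mapping.keys ?p. Poly_Mapping.single J (Poly_Mapping.lookup ?p J))"
    by (rule poly_mapping_eqI) (auto simp: lookup_sum lookup_single when_def in_keys_iff)
  also have "\<dots> = ?c * xpow x k"
    unfolding sum_distrib_right
  proof (rule sum.cong[OF refl])
    fix J assume "J \<in> Poly_Mapping.keys ?p"
    from J1[OF this] have "J - Poly_Mapping.single x k + Poly_Mapping.single x k = J"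
      by (intro poly_mapping_eqI) (auto simp: lookup_add lookup_minus lookup_single when_def)
    then show "Poly_Mapping.single J (Poly_Mapping.lookup ?p J)
        = Poly_Mapping.single (J - Poly_Mapping.single x k) (Poly_Mapping.lookup ?p J) * xpow x k"
      by (simp add: mult_single)
  qed
  finally have "?p = ?c * xpow x k" .
  moreover have "vars_in X ?c"
    unfolding vars_in_def
  proof (intro allI impI below_sum)
    fix i J assume "i \<notin> X" "J \<in> Poly_Mapping.keys ?p"
    then have "Poly_Mapping.lookup (J - Poly_Mapping.single x k) i = 0"
      using J1[of J] J2[of J i] by (cases "i = x") (simp_all add: lookup_minus lookup_single)
    then show "below (\<lambda>J. Poly_Mapping.lookup J i) 1
        (Poly_Mapping.single (J - Poly_Mapping.single x k) (Poly_Mapping.lookup ?p J))"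
      by (simp add: below_def)
  qed
  ultimately show ?thesis using that[of ?c] by simp
qed

lemma xpow_nonzero: "(xpow x k :: ('n \<Rightarrow>\<^sub>0 nat) \<Rightarrow>\<^sub>0 'a::zero_neq_one) \<noteq> 0"
  by (metis lookup_single_eq lookup_zero zero_neq_one)

lemma xpow_add: "(xpow x (k + l) :: ('n \<Rightarrow>\<^sub>0 nat) \<Rightarrow>\<^sub>0 'a::comm_ring_1) = xpow x k * xpow x l"
  by (simp add: mult_single single_add)

lemma vars_in_xpow: "x \<in> X \<Longrightarrow> vars_in X (xpow x k :: ('n \<Rightarrow>\<^sub>0 nat) \<Rightarrow>\<^sub>0 'a::zero_neq_one)"
  by (auto simp: vars_in_def below_def lookup_single when_def)

lemma vars_in_homog:
  "x \<notin> X \<Longrightarrow> vars_in X p \<Longrightarrow> homog (\<lambda>J. Poly_Mapping.lookup J x) 0 p"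
  by (auto simp: vars_in_def below_def homog_def)

lemma dvd_part:
  fixes r f :: "('n::linorder \<Rightarrow>\<^sub>0 nat) \<Rightarrow>\<^sub>0 'a::comm_ring_1"
  assumes "x \<notin> X" "vars_in X r" "r dvd f"
  shows "r dvd part (\<lambda>J. Poly_Mapping.lookup J x) k f"
proof -
  obtain q where "f = r * q" using assms(3) by blast
  then show ?thesis using var.part_homog_mult[OF vars_in_homog[OF assms(1,2)], of k q] by simp
qed

text \<open>
  Comparing the pieces of degree \<open>k\<close> in \<open>x\<close> on both sides of \<open>c * x\<^sup>k = r * q\<close> replaces \<open>q\<close>
  by a multiple of \<open>x\<^sup>k\<close>, which then cancels.
\<close>

lemma dvd_coeff:
  fixes r c :: "('n::linorder \<Rightarrow>\<^sub>0 nat) \<Rightarrow>\<^sub>0 'a::idom"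
  assumes x: "x \<notin> X" and r: "vars_in X r" and c: "vars_in X c" and dvd: "r dvd c * xpow x k"
  shows "r dvd c"
proof (cases "c = 0")
  case False
  obtain q where q: "c * xpow x k = r * q" using dvd by blast
  have "c * xpow x k \<noteq> 0" using False xpow_nonzero[of x k] by simp
  moreover have "vars_in (insert x X) (c * xpow x k)"
    by (intro vars_in_mult vars_in_xpow vars_in_mono[OF c]) auto
  ultimately have "vars_in (insert x X) q" using vars_in_factor(2)[of "insert x X" r q] q by auto
  then obtain d where d: "part (\<lambda>J. Poly_Mapping.lookup J x) k q = d * xpow x k"
    by (rule part_eq_coeff_times_power)
  have 1: "homog (\<lambda>J. Poly_Mapping.lookup J x) (0 + k) (c * xpow x k)"
    by (intro var.homog_mult vars_in_homog[OF x c]) (simp add: homog_def)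
  have "c * xpow x k = r * (d * xpow x k)"
    using part_homog[OF 1, of k] var.part_homog_mult[OF vars_in_homog[OF x r], of k q] q d by simp
  then have "(c - r * d) * xpow x k = 0" by (simp add: algebra_simps)
  then have "c = r * d" using xpow_nonzero[of x k, where 'a='a] by simp
  then show ?thesis by simp
qed simp

text \<open>
  Gauss's lemma. The prime \<open>r\<close>, which does not involve \<open>x\<close>, divides the product of the leading
  coefficients of \<open>a\<close> and \<open>b\<close> in \<open>x\<close>, hence one of them. The corresponding leading term can be
  removed, which lowers the degree in \<open>x\<close>.
\<close>

lemma prime_in_extension:
  fixes T :: "'a::field itself" and X :: "'n::{finite,linorder} set"
  assumes prime: "primes_within X X T" and x: "x \<notin> X"
  shows "primes_within X (insert x X) T"
proof -
  let ?w = "\<lambda>J. Poly_Mapping.lookup J x"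
  have "r dvd a \<or> r dvd b"
    if r: "irreducible r" "vars_in X r" and "vars_in (insert x X) a" "vars_in (insert x X) b" "r dvd a * b"
      "below ?w m a" "below ?w n b" for r a b :: "('n \<Rightarrow>\<^sub>0 nat) \<Rightarrow>\<^sub>0 'a" and m n
    using that(3-)
  proof (induction "m + n" arbitrary: m n a b rule: less_induct)
    case less
    show ?case
    proof (cases "m = 0 \<or> n = 0")
      case True
      then show ?thesis using less.prems by auto
    next
      case False
      then obtain m' n' where mn: "m = Suc m'" "n = Suc n'" by (meson nat.exhaust)
      obtain c where c: "vars_in X c" "part ?w m' a = c * xpow x m'"
        using part_eq_coeff_times_power[OF less.prems(1)] by blast
      obtain d where d: "vars_in X d" "part ?w n' b = d * xpow x n'"
        using part_eq_coeff_times_power[OF less.prems(2)] by blast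
      have "part ?w (m' + n') (a * b) = (c * d) * xpow x (m' + n')"
        using var.part_top_mult[of x m' a n' b] less.prems mn c d by (simp add: xpow_add mult_ac)
      then have "r dvd (c * d) * xpow x (m' + n')"
        using dvd_part[OF x r(2) less.prems(3), of "m' + n'"] by simp
      then have "r dvd c * d"
        using dvd_coeff[OF x r(2) vars_in_mult[OF c(1) d(1)]] by blast
      then consider "r dvd c" | "r dvd d"
        using prime r c d unfolding primes_within_def by blast
      then show ?thesis
      proof cases
        case 1
        let ?a = "a - part ?w m' a"
        have dv: "r dvd part ?w m' a" using 1 c by simp
        have "r dvd ?a * b" using dv less.prems(3) by (simp add: algebra_simps)
        moreover have "vars_in (insert x X) ?a" by (intro vars_in_diff vars_in_part less.prems(1))
        ultimately have "r dvd ?a \<or> r dvd b"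
          using less.hyps[of m' n ?a b] less.prems mn below_minus_part[of ?w m' a] by auto
        then show ?thesis using dv by (metis dvd_add diff_add_cancel)
      next
        case 2
        let ?b = "b - part ?w n' b"
        have dv: "r dvd part ?w n' b" using 2 d by simp
        have "r dvd a * ?b" using dv less.prems(3) by (simp add: algebra_simps)
        moreover have "vars_in (insert x X) ?b" by (intro vars_in_diff vars_in_part less.prems(2))
        ultimately have "r dvd a \<or> r dvd ?b"
          using less.hyps[of m n' a ?b] less.prems mn below_minus_part[of ?w n' b] by auto
        then show ?thesis using dv by (metis dvd_add diff_add_cancel)
      qed
    qed
  qed
  then show ?thesis unfolding primes_within_def using below_exists[of ?w] by metis
qed

lemma unit_mult_dvd:
  fixes c q :: "'a::comm_semiring_1"
  assumes "c dvd 1"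
  shows "c * q dvd q"
proof -
  obtain u where u: "1 = c * u" using assms by (rule dvdE)
  have "c * q * u = c * u * q" by (simp add: mult_ac)
  then have "q = c * q * u" by (simp flip: u)
  then show ?thesis by (rule dvdI)
qed

lemma vars_in_dvd:
  fixes p q :: "('n::linorder \<Rightarrow>\<^sub>0 nat) \<Rightarrow>\<^sub>0 'a::idom"
  assumes "p dvd q" "vars_in X q" "q \<noteq> 0"
  shows "vars_in X p"
  using assms(1)
proof (rule dvdE)
  fix k assume "q = p * k"
  then show ?thesis using vars_in_factor(1)[of X p k] assms(2,3) by simp
qed

text \<open>
  Moving the prime factors of \<open>r\<close> to the right of \<open>r * b = p * w\<close> cannot touch \<open>p\<close> beyond a
  unit, since \<open>p\<close> is irreducible and is not itself in \<open>K[X]\<close>.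
\<close>

lemma dvd_cancel_coefficient:
  fixes p r b :: "('n::{finite,linorder} \<Rightarrow>\<^sub>0 nat) \<Rightarrow>\<^sub>0 'a::field"
  assumes prime: "primes_within X Y TYPE('a)" and XY: "X \<subseteq> Y"
    and p: "irreducible p" "\<not> vars_in X p"
    and r: "vars_in X r" "r \<noteq> 0" and b: "vars_in Y b" and dvd: "p dvd r * b"
  shows "p dvd b"
proof (cases "b = 0")
  case False
  obtain w where "r * b = p * w" using dvd by (rule dvdE)
  from distribute_factor[OF prime XY r b False this] obtain c1 c2 q' r' where
    c: "r = c1 * c2" "p = c1 * q'" "b = q' * r'" by (elim exE conjE)
  have c1: "vars_in X c1" using vars_in_factor(1)[of X c1 c2] c(1) r by simp
  have "\<not> q' dvd 1"
  proof
    assume "q' dvd 1"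
    then have "vars_in X q'" by (rule vars_in_dvd) simp_all
    then show False using vars_in_mult[OF c1] c(2) p(2) by simp
  qed
  then have "c1 dvd 1" using irreducibleD[OF p(1) c(2)] by simp
  then have "p dvd q'" unfolding c(2) by (rule unit_mult_dvd)
  then show ?thesis unfolding c(3) by (rule dvd_mult2)
qed simp

text \<open>
  Among the nonzero elements \<open>p * u + a * v\<close> let \<open>r\<close> have least degree in \<open>x\<close>. By pseudo-division,
  \<open>r\<close> divides \<open>p\<close> and \<open>a\<close> up to nonzero factors from \<open>K[X]\<close>. Since \<open>p\<close> is irreducible, \<open>r\<close> is,
  up to such a factor, either a unit or associated to \<open>p\<close>. In the first case \<open>r * b\<close> is a multiple
  of \<open>p\<close> and so is \<open>b\<close>; in the second \<open>a\<close> is one. The factors from \<open>K[X]\<close> can be cancelled because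
  \<open>p\<close> involves \<open>x\<close>.
\<close>

lemma prime_of_new_variable:
  fixes p a b :: "('n::{finite,linorder} \<Rightarrow>\<^sub>0 nat) \<Rightarrow>\<^sub>0 'a::field"
  assumes prime: "primes_within X (insert x X) TYPE('a)" and x: "x \<notin> X"
    and p: "irreducible p" "vars_in (insert x X) p" "\<not> vars_in X p"
    and a: "vars_in (insert x X) a" and b: "vars_in (insert x X) b" and dvd: "p dvd a * b"
  shows "p dvd a \<or> p dvd b"
proof -
  let ?w = "\<lambda>J. Poly_Mapping.lookup J x" and ?Y = "insert x X"
  define I where "I = {p * u + a * v | u v. vars_in ?Y u \<and> vars_in ?Y v}"
  have XY: "X \<subseteq> ?Y" by auto
  have IY: "vars_in ?Y f" if "f \<in> I" for f
    using that p a unfolding I_def by (auto intro!: vars_in_add vars_in_mult)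
  have I_scale: "g * f \<in> I" if f: "f \<in> I" and g: "vars_in ?Y g" for f g
  proof -
    obtain u v where "f = p * u + a * v" "vars_in ?Y u" "vars_in ?Y v" using f unfolding I_def by blast
    moreover from this have "g * f = p * (g * u) + a * (g * v)" by (simp add: algebra_simps)
    ultimately show ?thesis unfolding I_def by (intro CollectI exI[of _ "g * u"] exI[of _ "g * v"] conjI) (simp_all add: vars_in_mult g)
  qed
  have I_diff: "f - g \<in> I" if fI: "f \<in> I" and gI: "g \<in> I" for f g
  proof -
    obtain u v where f: "f = p * u + a * v" "vars_in ?Y u" "vars_in ?Y v" using fI unfolding I_def by blast
    obtain u' v' where g: "g = p * u' + a * v'" "vars_in ?Y u'" "vars_in ?Y v'" using gI unfolding I_def by blast
    have "f - g = p * (u - u') + a * (v - v')" using f g by (simp add: algebra_simps)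
    then show ?thesis unfolding I_def using vars_in_diff[OF f(2) g(2)] vars_in_diff[OF f(3) g(3)]
      by (intro CollectI exI[of _ "u - u'"] exI[of _ "v - v'"] conjI)
  qed
  have pI: "p \<in> I" unfolding I_def
    by (rule CollectI, rule exI[of _ 1], rule exI[of _ 0]) simp
  have aI: "a \<in> I" unfolding I_def
    by (rule CollectI, rule exI[of _ 0], rule exI[of _ 1]) simp
  have p0: "p \<noteq> 0" using p(3) by auto
  define P where "P m \<longleftrightarrow> (\<exists>r\<in>I. r \<noteq> 0 \<and> below ?w m r)" for m
  obtain mp where "below ?w mp p" using below_exists[of ?w p] by (rule exE)
  then have "P mp" unfolding P_def using pI p0 by (intro bexI[of _ p] conjI)
  define m where "m = (LEAST m. P m)"
  have "P m" unfolding m_def using \<open>P mp\<close> by (rule LeastI)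
  then obtain r where r: "r \<in> I" "r \<noteq> 0" "below ?w m r" unfolding P_def by (elim bexE conjE)
  have min: "f = 0" if "f \<in> I" "below ?w k f" "k < m" for f k
    using that not_less_Least[of k P] unfolding m_def P_def by auto
  have "m \<noteq> 0" using r by (auto intro: Nat.gr0I)
  then obtain n where n: "m = Suc n" by (cases m) auto
  obtain l where l: "vars_in X l" "part ?w n r = l * xpow x n"
    using part_eq_coeff_times_power[OF IY[OF r(1)]] .
  have l0: "l \<noteq> 0"
  proof
    assume "l = 0"
    then have "below ?w n r" using below_minus_part[of ?w n r] r n l by simp
    then show False using min[OF r(1), of n] n r by simp
  qed
  have pseudo: "\<exists>c h. vars_in X c \<and> c \<noteq> 0 \<and> c * f = h * r" if "f \<in> I" "below ?w k f" for f k
    using that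
  proof (induction k arbitrary: f)
    case 0
    then show ?case by (intro exI[of _ 1] exI[of _ 0]) simp
  next
    case (Suc k)
    show ?case
    proof (cases "k < n")
      case True
      then have "f = 0" using min[OF Suc.prems] n by simp
      then show ?thesis by (intro exI[of _ 1] exI[of _ 0]) simp
    next
      case False
      obtain d where d: "vars_in X d" "part ?w k f = d * xpow x k"
        using part_eq_coeff_times_power[OF IY[OF Suc.prems(1)]] .
      define e where "e = d * xpow x (k - n)"
      have "homog ?w (k - n) (xpow x (k - n) :: ('n \<Rightarrow>\<^sub>0 nat) \<Rightarrow>\<^sub>0 'a)" by (simp add: homog_def)
      from var.homog_mult[OF vars_in_homog[OF x d(1)] this]
      have e: "homog ?w (0 + (k - n)) e" unfolding e_def .
      have eY: "vars_in ?Y e"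
        unfolding e_def by (intro vars_in_mult vars_in_xpow vars_in_mono[OF d(1) XY] insertI1)
      have l': "homog ?w 0 l" "vars_in ?Y l"
        using vars_in_homog[OF x l(1)] vars_in_mono[OF l(1) XY] by auto
      \<comment> \<open>One step of pseudo-division: the leading terms in \<open>x\<close> of \<open>l * f\<close> and \<open>e * r\<close> agree.\<close>
      let ?g = "l * f - e * r"
      have gI: "?g \<in> I" by (intro I_diff I_scale Suc.prems r l' eY)
      have "l * part ?w k f = e * part ?w n r"
        using False xpow_add[of x "k - n" n, where 'a='a] unfolding d(2) l(2) e_def by (simp add: mult_ac)
      then have "?g = l * (f - part ?w k f) - e * (r - part ?w n r)"
        by (simp add: algebra_simps)
      moreover have "below ?w k (l * (f - part ?w k f))"
        using var.below_mult[OF below_minus_part[OF Suc.prems(2)] homog_below[OF l'(1)]]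
        by (simp add: mult.commute)
      moreover have "below ?w k (e * (r - part ?w n r))"
        using var.below_mult[OF below_minus_part[of ?w n r] homog_below[OF e]] r n False
        by (simp add: mult.commute)
      ultimately have "below ?w k ?g" by (simp only: below_diff)
      from Suc.IH[OF gI this] obtain c h where
        ch: "vars_in X c" "c \<noteq> 0" "c * ?g = h * r" by (elim exE conjE)
      then have "(c * l) * f = (h + c * e) * r" by (simp add: algebra_simps)
      moreover have "c * l \<noteq> 0" using ch(2) l0 by simp
      ultimately show ?thesis using vars_in_mult[OF ch(1) l(1)]
        by (intro exI[of _ "c * l"] exI[of _ "h + c * e"] conjI)
    qed
  qed
  have multiple: "\<exists>c h. vars_in X c \<and> c \<noteq> 0 \<and> c * f = h * r" if "f \<in> I" for f
  proof -
    obtain k where "below ?w k f" using below_exists[of ?w f] by (rule exE)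
    then show ?thesis by (rule pseudo[OF that])
  qed
  obtain c h where c: "vars_in X c" "c \<noteq> 0" "c * p = h * r"
    using multiple[OF pI] by (elim exE conjE)
  from distribute_factor[OF prime XY c(1,2) p(2) p0 c(3)] obtain c1 c2 h' r' where
    s: "c = c1 * c2" "r = c2 * r'" "p = h' * r'" by (elim exE conjE)
  from irreducibleD[OF p(1) s(3)] show ?thesis
  proof
    assume "r' dvd 1"
    then have "vars_in X r'" by (rule vars_in_dvd) simp_all
    moreover have "vars_in X c2" using vars_in_factor(2)[of X c1 c2] s c by simp
    ultimately have rX: "vars_in X r" unfolding s(2) by (intro vars_in_mult)
    obtain u v where "r = p * u + a * v" using r(1) by (auto simp: I_def)
    then have "r * b = p * (u * b) + (a * b) * v" by (simp add: algebra_simps)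
    then have "p dvd r * b" using dvd by simp
    then show ?thesis using dvd_cancel_coefficient[OF prime XY p(1,3) rX r(2) b] by simp
  next
    assume "h' dvd 1"
    then have "p dvd r'" unfolding s(3) by (rule unit_mult_dvd)
    then have "p dvd r" unfolding s(2) by (rule dvd_mult)
    moreover obtain c' k where c': "vars_in X c'" "c' \<noteq> 0" "c' * a = k * r"
      using multiple[OF aI] by (elim exE conjE)
    ultimately have "p dvd c' * a" by simp
    then show ?thesis using dvd_cancel_coefficient[OF prime XY p(1,3) c'(1,2) a] by simp
  qed
qed

lemma primes_within_all:
  fixes X :: "'n::{finite,linorder} set"
  shows "primes_within X X TYPE('a::field)"
  using finite[of X]
proof (induction X rule: finite_induct)
  case empty
  have False if "irreducible r" "vars_in {} r" for r :: "('n \<Rightarrow>\<^sub>0 nat) \<Rightarrow>\<^sub>0 'a"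
    using that vars_in_empty_unit[of r] by (auto simp: irreducible_def)
  then show ?case unfolding primes_within_def by blast
next
  case (insert x X)
  have P: "primes_within X (insert x X) TYPE('a)"
    by (rule prime_in_extension[OF insert.IH insert.hyps(2)])
  show ?case
    unfolding primes_within_def
  proof (intro allI impI)
    fix r a b :: "('n \<Rightarrow>\<^sub>0 nat) \<Rightarrow>\<^sub>0 'a"
    assume r: "irreducible r" "vars_in (insert x X) r"
      and ab: "vars_in (insert x X) a" "vars_in (insert x X) b" "r dvd a * b"
    show "r dvd a \<or> r dvd b"
    proof (cases "vars_in X r")
      case True
      with P r ab show ?thesis unfolding primes_within_def by simp
    next
      case False
      from prime_of_new_variable[OF P insert.hyps(2) r False ab] show ?thesis .
    qed
  qed
qed

lemma irreducible_dvd_mult: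
  fixes r a b :: "('n::{finite,linorder} \<Rightarrow>\<^sub>0 nat) \<Rightarrow>\<^sub>0 'a::field"
  assumes "irreducible r" "r dvd a * b"
  shows "r dvd a \<or> r dvd b"
  using primes_within_all[of "UNIV :: 'n set", where 'a='a] assms unfolding primes_within_def by simp

text \<open>
  No prime factor of \<open>a\<close> divides \<open>c\<close>, so all of them can be cancelled from \<open>b\<close> in turn.
\<close>

lemma coprime_dvd_mult_imp_dvd:
  fixes a b c :: "('n::{finite,linorder} \<Rightarrow>\<^sub>0 nat) \<Rightarrow>\<^sub>0 'a::field"
  assumes "a \<noteq> 0" "\<And>d. d dvd a \<Longrightarrow> d dvd c \<Longrightarrow> d dvd 1" "a dvd b * c"
  shows "a dvd b"
proof -
  obtain k where "below mdeg k a" using below_exists[of mdeg a] by (rule exE)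
  then show ?thesis using assms
  proof (induction k arbitrary: a b)
    case (Suc k)
    show ?case
    proof (cases "a dvd 1")
      case True
      then show ?thesis using dvd_trans[of a 1 b] by simp
    next
      case False
      obtain r where r: "irreducible r" "r dvd a"
        using irreducible_factor_exists[OF Suc.prems(2) False] by (elim exE conjE)
      have nu: "\<not> r dvd 1" using r(1) by (rule irreducible_not_unit)
      have "\<not> r dvd c" using Suc.prems(3)[OF r(2)] nu by blast
      then have "r dvd b"
        using irreducible_dvd_mult[OF r(1) dvd_trans[OF r(2) Suc.prems(4)]] by simp
      then obtain b' where b': "b = r * b'" by (rule dvdE)
      obtain a' where a': "a = r * a'" using r(2) by (rule dvdE)
      have r0: "r \<noteq> 0" "a' \<noteq> 0" using a' Suc.prems(2) by auto
      obtain q where "b * c = a * q" using Suc.prems(4) by (rule dvdE)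
      then have "r * (b' * c) = r * (a' * q)" using a' b' by (simp add: mult_ac)
      then have "a' dvd b' * c" using r0 by simp
      moreover have "below mdeg k a'"
        by (rule below_mdeg_cofactor[of k r a']) (use Suc.prems(1,2) a' nu in simp_all)
      moreover have "d dvd 1" if "d dvd a'" "d dvd c" for d
        using Suc.prems(3)[of d] that unfolding a' by (simp add: dvd_mult)
      ultimately have "a' dvd b'" using Suc.IH[of a' b'] r0(2) by simp
      then show ?thesis unfolding a' b' by (rule mult_dvd_mono[OF dvd_refl])
    qed
  qed simp
qed

section \<open>Symbols of operators\<close>

lemma lpdo_ord_eq:
  fixes L :: "('n::finite \<Rightarrow>\<^sub>0 nat) \<Rightarrow>\<^sub>0 'a::comm_monoid_add"
  assumes "part mdeg d L \<noteq> 0" "below mdeg (Suc d) L"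
  shows "lpdo_ord L = ereal (real d)"
proof -
  have L: "L \<noteq> 0" using assms(1) by auto
  have "\<not> below mdeg d L" using assms(1) part_below by auto
  then obtain J where "J \<in> Poly_Mapping.keys L" "mdeg J = d"
    using assms(2) unfolding below_def by (auto simp: less_Suc_eq)
  then have "Max (mdeg ` Poly_Mapping.keys L) = d"
    using assms(2) by (intro Max_eqI) (auto simp: below_def less_Suc_eq_le)
  then show ?thesis using L by (simp add: lpdo_ord_def)
qed

lemma lpdo_ord_less_iff_below:
  fixes L :: "('n::finite \<Rightarrow>\<^sub>0 nat) \<Rightarrow>\<^sub>0 'a::comm_monoid_add"
  shows "lpdo_ord L < ereal (real d) \<longleftrightarrow> below mdeg d L"
proof (cases "L = 0")
  case False
  then obtain k where k: "part mdeg k L \<noteq> 0" "below mdeg (Suc k) L" by (rule top_part_exists)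
  then show ?thesis
    using part_nonzero_less[OF k(1), of d] below_mono[OF k(2), of d] by (auto simp: lpdo_ord_eq[OF k])
qed (simp add: lpdo_ord_def)

lemma Sym_0 [simp]: "Sym 0 = 0"
  by (simp add: Sym_def)

lemma Sym_eq_part:
  assumes "part mdeg d L \<noteq> 0" "below mdeg (Suc d) L"
  shows "Sym L = part mdeg d L"
  unfolding Sym_def part_def lpdo_ord_eq[OF assms] by simp

lemma Sym_eq_0_iff [simp]: "Sym L = 0 \<longleftrightarrow> L = 0"
proof (cases "L = 0")
  case False
  then obtain k where k: "part mdeg k L \<noteq> 0" "below mdeg (Suc k) L" by (rule top_part_exists)
  then show ?thesis using False by (simp add: Sym_eq_part)
qed simp

text \<open>
  Having a prescribed nonzero symbol is a degree bound on a difference. This turns every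
  comparison of symbols below into additions of degree bounds.
\<close>

lemma Sym_eq_iff:
  assumes S: "homog mdeg d S" "S \<noteq> 0"
  shows "Sym L = S \<longleftrightarrow> below mdeg d (L - S)"
proof
  assume LS: "Sym L = S"
  then have "L \<noteq> 0" using S(2) by auto
  then obtain k where k: "part mdeg k L \<noteq> 0" "below mdeg (Suc k) L" by (rule top_part_exists)
  then have "S = part mdeg k L" using LS Sym_eq_part by auto
  moreover from this have "k = d"
    using S part_homog[OF homog_part, of mdeg d k L] part_homog[OF S(1), of d] by (auto split: if_splits)
  ultimately show "below mdeg d (L - S)" using below_minus_part[OF k(2)] by simp
next
  assume b: "below mdeg d (L - S)"
  have L: "L = (L - S) + S" by simp
  have "part mdeg d L = S"
    by (subst L, subst part_add) (simp add: part_below[OF b] part_homog[OF S(1)])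
  moreover have "below mdeg (Suc d) L"
    by (subst L) (intro below_add below_mono[OF b] homog_below[OF S(1)], simp)
  ultimately show "Sym L = S" using Sym_eq_part[of d L] S(2) by simp
qed

lemma Sym_homog:
  assumes "homog mdeg d S"
  shows "Sym S = S"
proof (cases "S = 0")
  case False
  show ?thesis unfolding Sym_eq_iff[OF assms False] by simp
qed simp

context commuting_derivations
begin

lemma below_map_deriv: "below w m Q \<Longrightarrow> below w m (Poly_Mapping.map (\<delta> i) Q)"
  by (auto simp: below_def in_keys_iff)

lemma mdeg_single [simp]: "mdeg (Poly_Mapping.single i k :: 'n \<Rightarrow>\<^sub>0 nat) = k"
  by (simp add: mdeg_def lookup_single when_def)

text \<open>
  In \<open>D\<^sub>i \<circ> P = X\<^sub>i * P + \<partial>\<^sub>i P\<close> the second term does not raise the degree. Hence composition with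
  \<open>D\<^sup>J\<close> is multiplication with \<open>X\<^sup>J\<close> up to terms of lower order.
\<close>

lemma Dpow_comp_leading:
  assumes Q: "below mdeg (Suc n) Q"
  shows "below mdeg (mdeg J + n) (Dpow_comp \<delta> J Q - Poly_Mapping.single J 1 * Q)"
proof (induction k \<equiv> "mdeg J" arbitrary: J)
  case 0
  then have "J = 0" by (intro poly_mapping_eqI) (simp add: mdeg_def)
  then show ?case by simp
next
  case (Suc k)
  have "\<exists>i. Poly_Mapping.lookup J i \<noteq> 0"
  proof (rule ccontr)
    assume "\<not> ?thesis"
    then have "mdeg J = 0" by (simp add: mdeg_def)
    with Suc.hyps(2) show False by simp
  qed
  then obtain i where i: "Poly_Mapping.lookup J i \<noteq> 0" by (rule exE)
  define J' where "J' = J - Poly_Mapping.single i 1"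
  have J: "J = Poly_Mapping.single i 1 + J'"
    unfolding J'_def using i
    by (intro poly_mapping_eqI) (auto simp: lookup_add lookup_minus lookup_single when_def)
  have deg: "mdeg J = Suc (mdeg J')" unfolding J by (simp add: deg.w_add)
  define P where "P = Dpow_comp \<delta> J' Q"
  let ?X = "Poly_Mapping.single J' (1 :: 'a) * Q"
  have low: "below mdeg (mdeg J' + n) (P - ?X)"
    unfolding P_def by (rule Suc.hyps(1)) (use Suc.hyps(2) deg in simp)
  have "below mdeg (Suc (mdeg J') + n) ?X"
    by (rule deg.below_mult[OF _ Q]) (simp add: below_def)
  moreover have "below mdeg (Suc (mdeg J') + n) (P - ?X)"
    by (rule below_mono[OF low]) simp
  ultimately have "below mdeg (Suc (mdeg J') + n) ((P - ?X) + ?X)" by (intro below_add)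
  then have "below mdeg (mdeg J + n) P" by (simp add: deg)
  then have 1: "below mdeg (mdeg J + n) (Poly_Mapping.map (\<delta> i) P)" by (rule below_map_deriv)
  have "below mdeg ((mdeg J' + n) + 1) ((P - ?X) * Dop i)"
    by (rule deg.below_mult[OF low]) (simp add: below_def)
  then have 2: "below mdeg (mdeg J + n) (Dop i * (P - ?X))" by (simp add: deg mult.commute)
  have X: "Poly_Mapping.single J (1 :: 'a) = Dop i * Poly_Mapping.single J' 1"
    unfolding J by (simp add: mult_single)
  have "Dpow_comp \<delta> J Q = D_comp \<delta> i P" unfolding J P_def by (rule Dpow_comp_Suc)
  then have "Dpow_comp \<delta> J Q - Poly_Mapping.single J 1 * Q
      = Dop i * (P - ?X) + Poly_Mapping.map (\<delta> i) P"
    unfolding X D_comp_def by (simp only: right_diff_distrib mult.assoc) simp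
  then show ?case using below_add[OF 2 1] by simp
qed

lemma comp_leading:
  assumes P: "below mdeg (Suc m) P" and Q: "below mdeg (Suc n) Q"
  shows "below mdeg (m + n) (lpdo_comp \<delta> P Q - P * Q)"
proof -
  let ?a = "Poly_Mapping.lookup P"
  have P_eq: "P = (\<Sum>J\<in>Poly_Mapping.keys P. Poly_Mapping.single J (?a J))"
    by (rule poly_mapping_eqI) (auto simp: lookup_sum lookup_single when_def in_keys_iff)
  have PQ: "P * Q = (\<Sum>J\<in>Poly_Mapping.keys P. Poly_Mapping.single J (?a J) * Q)"
    by (subst P_eq) (simp only: sum_distrib_right)
  have "lpdo_comp \<delta> P Q - P * Q
      = (\<Sum>J\<in>Poly_Mapping.keys P. Kop (?a J) * Dpow_comp \<delta> J Q - Poly_Mapping.single J (?a J) * Q)"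
    unfolding comp_alt[OF finite_keys order_refl] PQ by (simp add: sum_subtractf)
  moreover have "below mdeg (m + n) (Kop (?a J) * Dpow_comp \<delta> J Q - Poly_Mapping.single J (?a J) * Q)"
    if J: "J \<in> Poly_Mapping.keys P" for J
  proof -
    let ?R = "Dpow_comp \<delta> J Q - Poly_Mapping.single J 1 * Q"
    have "Poly_Mapping.single J (?a J) = Kop (?a J) * Poly_Mapping.single J 1"
      by (simp add: mult_single)
    then have "Kop (?a J) * Dpow_comp \<delta> J Q - Poly_Mapping.single J (?a J) * Q = ?R * Kop (?a J)"
      by (simp only:) (simp add: algebra_simps)
    moreover have "below mdeg ((mdeg J + n) + 0) (?R * Kop (?a J))"
      by (rule deg.below_mult[OF Dpow_comp_leading[OF Q]]) (simp add: below_def mdeg_def)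
    moreover have "mdeg J \<le> m" using P J by (auto simp: below_def)
    ultimately show ?thesis using below_mono[of mdeg "mdeg J + n + 0" _ "m + n"] by simp
  qed
  ultimately show ?thesis by (simp only: below_sum)
qed

lemma Sym_comp: "Sym (lpdo_comp \<delta> P Q) = Sym P * Sym Q"
proof (cases "P = 0 \<or> Q = 0")
  case True
  then show ?thesis by auto
next
  case False
  then have "P \<noteq> 0" "Q \<noteq> 0" by auto
  obtain m where m: "part mdeg m P \<noteq> 0" "below mdeg (Suc m) P" using top_part_exists[OF \<open>P \<noteq> 0\<close>] .
  obtain n where n: "part mdeg n Q \<noteq> 0" "below mdeg (Suc n) Q" using top_part_exists[OF \<open>Q \<noteq> 0\<close>] .
  let ?S = "part mdeg m P * part mdeg n Q"
  have S: "homog mdeg (m + n) ?S" by (intro deg.homog_mult homog_part)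
  have S0: "?S \<noteq> 0" using m(1) n(1) by simp
  have "below mdeg (Suc (m + n)) (P * Q)" using deg.below_mult[OF m(2) n(2)] by simp
  then have "below mdeg (m + n) (P * Q - ?S)"
    using below_minus_part[of mdeg "m + n" "P * Q"] by (simp add: deg.part_top_mult[OF m(2) n(2)])
  from below_add[OF comp_leading[OF m(2) n(2)] this]
  have "below mdeg (m + n) (lpdo_comp \<delta> P Q - ?S)" by simp
  then have "Sym (lpdo_comp \<delta> P Q) = ?S" by (simp add: Sym_eq_iff[OF S S0])
  then show ?thesis by (simp add: Sym_eq_part[OF m] Sym_eq_part[OF n])
qed

lemma comp_diff_left: "lpdo_comp \<delta> (P - P') Q = lpdo_comp \<delta> P Q - lpdo_comp \<delta> P' Q"
  using comp_add_left[of "P - P'" P' Q] by (simp add: algebra_simps)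

lemma comp_diff_right: "lpdo_comp \<delta> P (Q - Q') = lpdo_comp \<delta> P Q - lpdo_comp \<delta> P Q'"
  using comp_add_right[of P "Q - Q'" Q'] by (simp add: algebra_simps)

end

section \<open>Splitting off a left factor\<close>

context commuting_derivations
begin

text \<open>
  The heart of the proof. In \<open>T \<circ> G + R = F \<circ> E\<close> the operator \<open>R\<close> has order below that of \<open>G\<close>,
  so for \<open>T \<noteq> 0\<close> it does not affect the symbol of the left side. Hence \<open>S1\<close> divides
  \<open>Sym T * S3\<close>, and by coprimality it divides \<open>Sym T\<close>, say \<open>Sym T = S1 * Q\<close>. With \<open>Q\<close> read as an
  operator, \<open>T - F \<circ> Q\<close> has smaller order and satisfies an equation of the same form, with
  \<open>E - Q \<circ> G\<close> for \<open>E\<close>.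
\<close>

lemma left_divisible_of_product:
  fixes F G E T R :: "('n, 'a) lpdo"
  assumes S1: "homog mdeg d1 S1" "S1 \<noteq> 0" and S3: "homog mdeg d3 S3" "S3 \<noteq> 0"
    and coprime: "\<And>C. C dvd S1 \<Longrightarrow> C dvd S3 \<Longrightarrow> C dvd 1"
    and F: "Sym F = S1" and G: "Sym G = S3" and R: "below mdeg d3 R"
    and T: "below mdeg k T" "k \<le> d1 + d2" and eq: "lpdo_comp \<delta> T G + R = lpdo_comp \<delta> F E"
  shows "\<exists>H. T = lpdo_comp \<delta> F H \<and> below mdeg d2 H"
  using T eq
proof (induction k arbitrary: T E)
  case 0
  then show ?case by (intro exI[of _ 0]) simp
next
  case (Suc k)
  show ?case
  proof (cases "part mdeg k T = 0")
    case True
    then have "below mdeg k T" using below_minus_part[OF Suc.prems(1)] by simp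
    then show ?thesis using Suc.IH[OF _ _ Suc.prems(3)] Suc.prems(2) by simp
  next
    case False
    let ?t = "part mdeg k T"
    have t: "Sym T = ?t" using False Suc.prems(1) by (rule Sym_eq_part)
    have h: "homog mdeg (k + d3) (?t * S3)" by (intro deg.homog_mult homog_part S3)
    have h0: "?t * S3 \<noteq> 0" using False S3(2) by simp
    have "Sym (lpdo_comp \<delta> T G) = ?t * S3" by (simp add: Sym_comp t G)
    then have "below mdeg (k + d3) (lpdo_comp \<delta> T G - ?t * S3)" by (simp only: Sym_eq_iff[OF h h0])
    from below_add[OF this below_mono[OF R, of "k + d3"]]
    have "below mdeg (k + d3) (lpdo_comp \<delta> F E - ?t * S3)"
      unfolding Suc.prems(3)[symmetric] by (simp add: algebra_simps)
    then have "Sym (lpdo_comp \<delta> F E) = ?t * S3" by (simp only: Sym_eq_iff[OF h h0])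
    then have "S1 dvd ?t * S3" unfolding Sym_comp F by (rule dvdI[OF sym])
    from coprime_dvd_mult_imp_dvd[OF S1(2) _ this] have "S1 dvd ?t" by (simp add: coprime)
    then obtain q where q: "?t = S1 * q" by (rule dvdE)
    have "d1 \<le> k"
    proof (rule ccontr)
      assume "\<not> d1 \<le> k"
      have "q \<noteq> 0" using q False by auto
      then obtain l where l: "part mdeg l q \<noteq> 0" "below mdeg (Suc l) q" by (rule top_part_exists)
      have "part mdeg (d1 + l) ?t = S1 * part mdeg l q"
        unfolding q by (rule deg.part_homog_mult[OF S1(1)])
      then have "part mdeg (d1 + l) ?t \<noteq> 0" using S1(2) l(1) by simp
      from part_nonzero_less[OF this homog_below[OF homog_part]] \<open>\<not> d1 \<le> k\<close> show False by simp
    qed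
    \<comment> \<open>The cofactor \<open>q\<close> is homogeneous; taking its piece of the right degree makes this evident.\<close>
    define Q where "Q = part mdeg (k - d1) q"
    have Q: "homog mdeg (k - d1) Q" unfolding Q_def by (rule homog_part)
    have tQ: "?t = S1 * Q"
      using deg.part_homog_mult[OF S1(1), of "k - d1" q] part_homog[OF homog_part, of mdeg k k T] \<open>d1 \<le> k\<close>
      unfolding Q_def by (simp flip: q)
    have "Sym (lpdo_comp \<delta> F Q) = ?t" by (simp add: Sym_comp F Sym_homog[OF Q] tQ)
    then have FQ: "below mdeg k (lpdo_comp \<delta> F Q - ?t)"
      by (simp only: Sym_eq_iff[OF homog_part False])
    from below_diff[OF below_minus_part[OF Suc.prems(1)] FQ]
    have low: "below mdeg k (T - lpdo_comp \<delta> F Q)" by simp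
    have "lpdo_comp \<delta> (T - lpdo_comp \<delta> F Q) G + R = lpdo_comp \<delta> F (E - lpdo_comp \<delta> Q G)"
      using Suc.prems(3) by (simp add: comp_diff_left comp_diff_right comp_assoc algebra_simps)
    from Suc.IH[OF low _ this] obtain H where
      H: "T - lpdo_comp \<delta> F Q = lpdo_comp \<delta> F H" "below mdeg d2 H" using Suc.prems(2) by auto
    have "below mdeg d2 (H + Q)"
      using below_add[OF H(2) below_mono[OF homog_below[OF Q]]] Suc.prems(2) \<open>d1 \<le> k\<close> by simp
    moreover have "T = lpdo_comp \<delta> F (H + Q)"
      using H(1) by (simp add: comp_add_right algebra_simps)
    ultimately show ?thesis by (intro exI[of _ "H + Q"] conjI)
  qed
qed

text \<open>
  The candidate \<open>S2\<close> for the second factor makes \<open>G12 - F \<circ> S2\<close> of order below that of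
  \<open>S1 * S2\<close>; the previous lemma then shows that this error is itself a left multiple of \<open>F\<close>, by
  an operator too small to change the symbol \<open>S2\<close>.
\<close>

lemma left_factor_splits_off:
  fixes A F E G12 G3 RU RV S1 S2 S3 :: "('n, 'a) lpdo"
  assumes S1: "homogeneous S1" and S2: "homogeneous S2" and S3: "homogeneous S3"
    and coprime: "\<And>C. C dvd S1 \<Longrightarrow> C dvd S3 \<Longrightarrow> C dvd 1"
    and U: "A - RU = lpdo_comp \<delta> F E" "Sym F = S1"
    and V: "A - RV = lpdo_comp \<delta> G12 G3" "Sym G12 = S1 * S2" "Sym G3 = S3"
    and ords: "lpdo_ord RU < lpdo_ord S3" "lpdo_ord RV < lpdo_ord S3"
  shows "\<exists>F H. G12 = lpdo_comp \<delta> F H \<and> Sym F = S1 \<and> Sym H = S2"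
proof -
  obtain d1 where d1: "homog mdeg d1 S1" using S1 unfolding homogeneous_def homog_def by (rule exE)
  obtain d2 where d2: "homog mdeg d2 S2" using S2 unfolding homogeneous_def homog_def by (rule exE)
  obtain d3 where d3: "homog mdeg d3 S3" using S3 unfolding homogeneous_def homog_def by (rule exE)
  show ?thesis
  proof (cases "S1 * S2 = 0")
    case True
    \<comment> \<open>Any operators with the prescribed symbols compose to 0, in particular the symbols themselves.\<close>
    then have "Sym G12 = 0" by (simp only: V(2))
    then have "G12 = 0" by simp
    moreover have "lpdo_comp \<delta> S1 S2 = 0" using True by auto
    ultimately show ?thesis
      by (intro exI[of _ S1] exI[of _ S2]) (simp add: Sym_homog[OF d1] Sym_homog[OF d2])
  next
    case False
    have S3nz: "S3 \<noteq> 0" using ords(1) by (auto simp: lpdo_ord_def)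
    have ordS3: "lpdo_ord S3 = ereal (real d3)"
      using lpdo_ord_eq[of d3 S3] S3nz part_homog[OF d3, of d3] homog_below[OF d3] by simp
    have R: "below mdeg d3 (RV - RU)"
      using ords unfolding ordS3 lpdo_ord_less_iff_below by (intro below_diff)
    let ?T = "G12 - lpdo_comp \<delta> F S2"
    have h: "homog mdeg (d1 + d2) (S1 * S2)" by (intro deg.homog_mult d1 d2)
    have FS2: "Sym (lpdo_comp \<delta> F S2) = S1 * S2" by (simp add: Sym_comp U(2) Sym_homog[OF d2])
    have "below mdeg (d1 + d2) (G12 - S1 * S2)" "below mdeg (d1 + d2) (lpdo_comp \<delta> F S2 - S1 * S2)"
      using V(2) FS2 by (simp_all only: Sym_eq_iff[OF h False])
    from below_diff[OF this] have T: "below mdeg (d1 + d2) ?T" by simp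
    have "lpdo_comp \<delta> G12 G3 + (RV - RU) = lpdo_comp \<delta> F E"
      by (simp flip: U(1) V(1))
    then have "lpdo_comp \<delta> ?T G3 + (RV - RU) = lpdo_comp \<delta> F (E - lpdo_comp \<delta> S2 G3)"
      by (simp add: comp_diff_left comp_diff_right comp_assoc algebra_simps)
    from left_divisible_of_product[OF d1 _ d3 S3nz coprime U(2) V(3) R T order_refl this] False
    obtain H where H: "?T = lpdo_comp \<delta> F H" "below mdeg d2 H" by auto
    have "G12 = lpdo_comp \<delta> F (H + S2)" using H(1) by (simp add: comp_add_right algebra_simps)
    moreover have "Sym (H + S2) = S2" using False H(2) by (simp add: Sym_eq_iff[OF d2])
    ultimately show ?thesis using U(2) by (intro exI[of _ F] exI[of _ "H + S2"] conjI)
  qed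
qed

lemma has_factorization_of_type_2:
  "has_factorization_of_type \<delta> [P, Q] L \<longleftrightarrow>
     (\<exists>F G. L = lpdo_comp \<delta> F G \<and> Sym F = P \<and> Sym G = Q)"
  (is "?l \<longleftrightarrow> ?r")
proof
  assume ?l
  then obtain Fs where L: "L = foldr (lpdo_comp \<delta>) Fs 1" and Fs: "map Sym Fs = [P, Q]"
    unfolding has_factorization_of_type_def by (elim conjE exE)
  from Fs obtain F G where "Fs = [F, G]" "Sym F = P" "Sym G = Q"
    by (auto simp: map_eq_Cons_conv)
  with L show ?r by (intro exI[of _ F] exI[of _ G]) (simp add: comp_1_right)
next
  assume ?r
  then obtain F G where "L = lpdo_comp \<delta> F G" "Sym F = P" "Sym G = Q"
    by (elim exE conjE)
  then show ?l
    unfolding has_factorization_of_type_def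
    by (intro conjI exI[of _ "[F, G]"]) (simp_all add: comp_1_right Sym_comp mult.assoc)
qed

lemma has_factorization_of_type_3:
  "has_factorization_of_type \<delta> [P, Q, S] L \<longleftrightarrow>
     (\<exists>F G H. L = lpdo_comp \<delta> F (lpdo_comp \<delta> G H) \<and> Sym F = P \<and> Sym G = Q \<and> Sym H = S)"
  (is "?l \<longleftrightarrow> ?r")
proof
  assume ?l
  then obtain Fs where L: "L = foldr (lpdo_comp \<delta>) Fs 1" and Fs: "map Sym Fs = [P, Q, S]"
    unfolding has_factorization_of_type_def by (elim conjE exE)
  from Fs obtain F G H where "Fs = [F, G, H]" "Sym F = P" "Sym G = Q" "Sym H = S"
    by (auto simp: map_eq_Cons_conv)
  with L show ?r by (intro exI[of _ F] exI[of _ G] exI[of _ H]) (simp add: comp_1_right)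
next
  assume ?r
  then obtain F G H where "L = lpdo_comp \<delta> F (lpdo_comp \<delta> G H)" "Sym F = P" "Sym G = Q" "Sym H = S"
    by (elim exE conjE)
  then show ?l
    unfolding has_factorization_of_type_def
    by (intro conjI exI[of _ "[F, G, H]"]) (simp_all add: comp_1_right Sym_comp mult.assoc)
qed

end

theorem theorem3p2:
  fixes \<delta> :: "'n::{finite,linorder} \<Rightarrow> 'a::field_char_0 \<Rightarrow> 'a"
    and A :: "('n, 'a) lpdo"
    and S1 S2 S3 :: "('n, 'a) mpoly"
    and U V W :: "('n, 'a) lpdo set"
  assumes "commuting_derivations \<delta>"
    and "Sym A = S1 * S2 * S3"
    and "homogeneous S1" "homogeneous S2" "homogeneous S3"
    and gcd_eq_1: "\<And>C. C dvd S1 \<Longrightarrow> C dvd S3 \<Longrightarrow> C dvd 1"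
    and "U = common_obstacles \<delta> A [S1, S2 * S3]"
    and "V = common_obstacles \<delta> A [S1 * S2, S3]"
    and "W = common_obstacles \<delta> A [S1, S2, S3]"
    and "V \<noteq> {}" "U \<noteq> {}"
    and "\<forall>R\<in>V. lpdo_ord R < lpdo_ord S3"
    and "\<forall>R\<in>U. lpdo_ord R < lpdo_ord S3"
  shows "W \<noteq> {} \<and> V = W"
proof -
  interpret commuting_derivations \<delta> by fact
  let ?two = "\<lambda>R. has_factorization_of_type \<delta> [S1 * S2, S3] (A - R)"
  let ?three = "\<lambda>R. has_factorization_of_type \<delta> [S1, S2, S3] (A - R)"
  have coarsen: "?two R" if three: "?three R" for R
  proof -
    obtain F G H where FGH: "A - R = lpdo_comp \<delta> F (lpdo_comp \<delta> G H)" "Sym F = S1" "Sym G = S2" "Sym H = S3"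
      using three unfolding has_factorization_of_type_3 by (elim exE conjE)
    then show ?thesis unfolding has_factorization_of_type_2
      by (intro exI[of _ "lpdo_comp \<delta> F G"] exI[of _ H]) (simp add: comp_assoc Sym_comp)
  qed
  obtain RU where RU: "RU \<in> U" using \<open>U \<noteq> {}\<close> by blast
  have refine: "?three R" if R: "R \<in> V" for R
  proof -
    obtain F E where FE: "A - RU = lpdo_comp \<delta> F E" "Sym F = S1"
      using RU unfolding \<open>U = _\<close> common_obstacles_def has_factorization_of_type_2 by blast
    obtain G12 G3 where G: "A - R = lpdo_comp \<delta> G12 G3" "Sym G12 = S1 * S2" "Sym G3 = S3"
      using R unfolding \<open>V = _\<close> common_obstacles_def has_factorization_of_type_2 by blast
    have "\<exists>F H. G12 = lpdo_comp \<delta> F H \<and> Sym F = S1 \<and> Sym H = S2"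
      by (rule left_factor_splits_off[OF assms(3-5) gcd_eq_1 FE G])
        (use assms(12,13) R RU in auto)
    then obtain F1 F2 where "G12 = lpdo_comp \<delta> F1 F2" "Sym F1 = S1" "Sym F2 = S2"
      by (elim exE conjE)
    then show ?thesis unfolding has_factorization_of_type_3 using G
      by (intro exI[of _ F1] exI[of _ F2] exI[of _ G3]) (simp add: comp_assoc)
  qed
  have VW: "V \<subseteq> W"
    using refine coarsen unfolding \<open>V = _\<close> \<open>W = _\<close> common_obstacles_def by blast
  obtain RV where RV: "RV \<in> V" using \<open>V \<noteq> {}\<close> by blast
  have "W \<subseteq> V"
  proof
    fix R assume R: "R \<in> W"
    then have "lpdo_ord R \<le> lpdo_ord RV"
      using refine[OF RV] unfolding \<open>W = _\<close> common_obstacles_def by blast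
    moreover have "lpdo_ord RV \<le> lpdo_ord R'" if "?two R'" for R'
      using RV that unfolding \<open>V = _\<close> common_obstacles_def by blast
    moreover have "?two R" using R coarsen unfolding \<open>W = _\<close> common_obstacles_def by blast
    ultimately show "R \<in> V" unfolding \<open>V = _\<close> common_obstacles_def by (blast intro: order_trans)
  qed
  with VW RV show ?thesis by blast
qed

end
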